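(* Let $\{a_n\}_{n\in\mathbb{N}}$ be a sequence of complex numbers such that $$\sum_{n=1}^\infty \frac{|a_n|}{n}<\infty .$$ Then for every $n\in\mathbb{N}$ $$a_n=\frac{2}{\pi^2}\, n\sinh(\pi n)\int_0^\infty K_{in}(x)\sum_{m=1}^\infty a_m J(x,im,\pi)\,\frac{dx}{x},$$ where the iterated series and integral converge absolutely.
   Context: $\mathbb{N}=\{1,2,\dots\}$ and $i$ is the imaginary unit. $K_\nu$ is the modified Bessel (Macdonald) function, $K_\nu(x)=\int_0^\infty e^{-x\cosh u}\cosh(\nu u)\,du$ for $x>0$, $\nu\in\mathbb{C}$; thus $K_{in}(x)=\int_0^\infty e^{-x\cosh u}\cos(nu)\,du$. The incomplete modified Bessel function is $J(z,\nu,w)=\int_0^w e^{-z\cosh u}\cosh(\nu u)\,du$; thus $J(x,im,\pi)=\int_0^\pi e^{-x\cosh u}\cos(mu)\,du$. *)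

theory Defs
  imports "HOL-Analysis.Analysis"
begin

text \<open>Arguments and values are complex even where the value is real, e.g. for
  purely imaginary order \<open>\<nu>\<close>, for which \<open>cosh (\<nu> u)\<close> is a cosine.\<close>

text \<open>The integral represents the Macdonald function only for \<open>x > 0\<close>.\<close>

definition bessel_K :: "complex \<Rightarrow> real \<Rightarrow> complex" where
  "bessel_K \<nu> x =
     (LINT u:{0<..}|lborel. complex_of_real (exp (- x * cosh u)) * cosh (\<nu> * complex_of_real u))"

text \<open>The interval integral is oriented, so the upper limit \<open>w\<close> may be any real.\<close>

definition incomplete_bessel :: "complex \<Rightarrow> complex \<Rightarrow> real \<Rightarrow> complex" where
  "incomplete_bessel z \<nu> w =
     (LBINT u=0..ereal w. exp (- z * complex_of_real (cosh u)) * cosh (\<nu> * complex_of_real u))"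

end

theory Submission
  imports Defs
begin

text \<open>The functions \<open>x \<mapsto> J(x, \<i> m, \<pi>)\<close> and \<open>x \<mapsto> K_{\<i> n}(x)\<close> are biorthogonal for the
  measure \<open>dx / x\<close> on the positive half-line, with diagonal value
  \<open>\<pi>\<^sup>2 / (2 n sinh (\<pi> n))\<close> (\<open>KJ_biorthogonal\<close>); the theorem follows by integrating the
  series term by term.

  Integration by parts (\<open>J_imag_by_parts\<close>) gives
  \<open>J(x, \<i> m, \<pi>) = (x / m) \<integral> exp (- x cosh u) sinh u sin (m u) du\<close> over \<open>0 \<le> u \<le> \<pi>\<close>,
  hence \<open>\<bar>J(x, \<i> m, \<pi>)\<bar> \<le> \<pi> sinh \<pi> x exp (- x) / m\<close>. Since \<open>exp (- x) K_0(x)\<close> is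
  integrable and dominates \<open>exp (- x) \<bar>K_{\<i> n}(x)\<bar>\<close>, the summability of \<open>\<bar>a_m\<bar> / m\<close> gives
  absolute convergence of everything and permits the exchange of sum and integral.

  The same formula reduces biorthogonality to the orthogonality of the sines on \<open>[0, \<pi>]\<close>,
  once the Laplace transform of \<open>K_{\<i> n}\<close> is known. By Fubini it is
  \<open>\<integral> K_{\<i> n}(x) exp (- x cosh u) dx = \<integral> cos (n v) / (cosh u + cosh v) dv\<close> over \<open>v > 0\<close>, and
  its value \<open>\<pi> sin (n u) / (sinh u sinh (\<pi> n))\<close> for \<open>u > 0\<close> (\<open>cosh_kernel_fourier\<close>)
  is obtained without residues: \<open>sinh u / (cosh u + cosh v)\<close> is the integral over
  \<open>[v - u, v + u]\<close> of the logistic density, whose Fourier transform is a beta integral, equal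
  to \<open>\<Gamma>(1 + \<i> n) \<Gamma>(1 - \<i> n) = \<pi> n / sinh (\<pi> n)\<close>.\<close>

section \<open>The beta integral over the real line\<close>

text \<open>Euler's integral after the substitution \<open>t = exp v\<close>. In this form scaling of \<open>t\<close> is
  translation of \<open>v\<close>, under which Lebesgue measure is invariant.\<close>

lemma Gamma_integral_exp:
  fixes z :: complex
  assumes "Re z > 0"
  shows "has_bochner_integral lborel (\<lambda>v::real. exp (z * of_real v - of_real (exp v))) (Gamma z)"
proof -
  let ?f = "\<lambda>t::real. of_real t powr (z - 1) / of_real (exp t) :: complex"
  let ?g = "\<lambda>v::real. exp (z * of_real v - of_real (exp v)) :: complex"
  have img: "range (exp :: real \<Rightarrow> real) = {0<..}"
    by (metis exp_gt_zero exp_ln greaterThan_iff rangeI subsetI subset_antisym image_subsetI)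
  have gf: "(\<lambda>v. \<bar>exp v\<bar> *\<^sub>R ?f (exp v)) = ?g"
  proof
    fix v :: real
    have "complex_of_real (exp v) powr (z - 1) = exp ((z - 1) * of_real v)"
      by (simp add: powr_def Ln_of_real del: of_real_exp)
    then show "\<bar>exp v\<bar> *\<^sub>R ?f (exp v) = ?g v"
      by (simp add: scaleR_conv_of_real exp_diff exp_add left_diff_distrib flip: exp_of_real)
  qed
  have "?f absolutely_integrable_on range exp \<and> integral (range exp) ?f = Gamma z"
    unfolding img using absolutely_integrable_Gamma_integral'[OF assms]
      integral_unique[OF Gamma_integral_complex'[OF assms]] by blast
  then have *: "?g absolutely_integrable_on UNIV \<and> integral UNIV ?g = Gamma z"
    by (subst (asm) has_absolute_integral_change_of_variables_real[symmetric, where S = UNIV and h = exp])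
       (auto intro!: derivative_eq_intros inj_onI simp: gf[symmetric])
  have meas: "?g \<in> borel_measurable lborel"
    unfolding measurable_lborel2 by (intro borel_measurable_continuous_onI continuous_intros)
  have int: "integrable lborel ?g"
    using * meas by (simp add: set_integrable_def integrable_completion)
  then have "integral\<^sup>L lborel ?g = integral UNIV ?g"
    using set_borel_integral_eq_integral(2)[of UNIV ?g] by (simp add: set_integrable_def set_lebesgue_integral_def)
  with int * show ?thesis by (simp add: has_bochner_integral_iff)
qed

text \<open>The integrand is \<open>exp (a v) / (1 + exp v) ^ (a + b)\<close>. Both sides are iterated integrals of
  the function \<open>f\<close> of the proof: its \<open>v\<close>-sections and its \<open>w\<close>-sections are multiples of
  translates of the integrand of \<open>Gamma_integral_exp\<close>.\<close>

lemma Beta_integral_exp: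
  fixes a b :: complex
  assumes a: "Re a > 0" and b: "Re b > 0"
  shows "integrable lborel (\<lambda>v::real. exp (a * of_real v - (a + b) * of_real (ln (1 + exp v))))"
    and "Gamma (a + b) * (LBINT v. exp (a * of_real v - (a + b) * of_real (ln (1 + exp v))))
           = Gamma a * Gamma b"
proof -
  define g where "g z v = exp (z * complex_of_real v - of_real (exp v))" for z v
  define f where "f w v = exp (a * of_real v + (a + b) * of_real w - of_real (exp w * (1 + exp v)))"
    for w v :: real
  define k where "k v = exp (a * of_real v - (a + b) * of_real (ln (1 + exp v)))" for v :: real
  have g: "has_bochner_integral lborel (g z) (Gamma z)" if "Re z > 0" for z
    unfolding g_def by (rule Gamma_integral_exp[OF that])
  have g_shift: "has_bochner_integral lborel (\<lambda>v. g z (t + v)) (Gamma z)" if "Re z > 0" for z t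
    using lborel_has_bochner_integral_real_affine_iff[of 1 "g z" "Gamma z" t] g[OF that] by simp
  have f1: "f w v = g b w * g a (w + v)" for w v
    by (simp add: f_def g_def exp_add[symmetric] algebra_simps)
  have f2: "f w v = k v * g (a + b) (ln (1 + exp v) + w)" for w v
  proof -
    have "exp (ln (1 + exp v) + w) = exp w * (1 + exp v)"
      by (simp add: exp_add add_pos_pos mult.commute)
    then show ?thesis
      unfolding f_def g_def k_def exp_add[symmetric] by (simp add: algebra_simps)
  qed
  have I1: "has_bochner_integral lborel (f w) (g b w * Gamma a)" for w
    unfolding f1[abs_def] by (intro has_bochner_integral_mult_right g_shift a)
  have I2: "has_bochner_integral lborel (\<lambda>w. f w v) (k v * Gamma (a + b))" for v
    unfolding f2[abs_def] using a b by (intro has_bochner_integral_mult_right g_shift) simp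
  have "(\<lambda>p. f (fst p) (snd p)) \<in> borel_measurable borel"
    unfolding f_def by (intro borel_measurable_continuous_onI continuous_intros)
  then have meas: "case_prod f \<in> borel_measurable (lborel \<Otimes>\<^sub>M lborel)"
    by (simp add: lborel_prod case_prod_unfold)
  have norm_int: "(LBINT v. norm (f w v)) = norm (g b w) * (LBINT v. norm (g a v))" for w
    using lborel_integral_real_affine[of 1 "\<lambda>v. norm (g a v)" w] by (simp add: f1 norm_mult)
  have pair: "integrable (lborel \<Otimes>\<^sub>M lborel) (case_prod f)"
  proof (rule lborel_pair.Fubini_integrable[OF meas])
    show "integrable lborel (\<lambda>w. LBINT v. norm (case_prod f (w, v)))"
      using g[OF b] by (simp add: norm_int has_bochner_integral_iff)
    show "AE w in lborel. integrable lborel (\<lambda>v. case_prod f (w, v))"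
      using I1 by (simp add: has_bochner_integral_iff)
  qed
  have nz: "Gamma (a + b) \<noteq> 0"
  proof (rule Gamma_nonzero)
    show "a + b \<notin> \<int>\<^sub>\<le>\<^sub>0"
    proof
      assume "a + b \<in> \<int>\<^sub>\<le>\<^sub>0"
      then obtain n :: int where n: "a + b = of_int n" "n \<le> 0" by (rule nonpos_Ints_cases)
      then have "Re (a + b) = of_int n" "real_of_int n \<le> 0"
        by (simp_all only: complex_Re_of_int of_int_le_0_iff)
      with a b show False by simp
    qed
  qed
  have kint: "integrable lborel (\<lambda>v. k v * Gamma (a + b))"
    using lborel_pair.integrable_snd[OF pair] I2 by (simp add: has_bochner_integral_iff)
  show "integrable lborel (\<lambda>v::real. exp (a * of_real v - (a + b) * of_real (ln (1 + exp v))))"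
    using integrable_mult_left[OF kint, of "inverse (Gamma (a + b))"] nz
    unfolding k_def by (simp add: mult.assoc)
  have "(LBINT v. k v * Gamma (a + b)) = (LBINT w. g b w * Gamma a)"
    using lborel_pair.Fubini_integral[OF pair] I1 I2 by (simp add: has_bochner_integral_iff)
  then show "Gamma (a + b) * (LBINT v. exp (a * of_real v - (a + b) * of_real (ln (1 + exp v))))
           = Gamma a * Gamma b"
    using g[OF b] unfolding k_def by (simp add: has_bochner_integral_iff mult.commute)
qed

section \<open>A cosine transform\<close>

text \<open>The density \<open>1 / (4 cosh\<^sup>2 (v / 2))\<close> of the logistic distribution.\<close>

definition logistic_density :: "real \<Rightarrow> real" where
  "logistic_density v = exp v / (1 + exp v)\<^sup>2"

lemma logistic_nonneg: "logistic_density v \<ge> 0"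
  by (simp add: logistic_density_def)

lemma continuous_on_logistic [continuous_intros]: "continuous_on A logistic_density"
proof -
  have "(1 + exp v :: real) \<noteq> 0" for v by (smt (verit) exp_gt_zero)
  then show ?thesis
    unfolding logistic_density_def[abs_def] by (intro continuous_intros) auto
qed

text \<open>The beta integral with \<open>a = 1 + \<i> \<nu>\<close> and \<open>b = 1 - \<i> \<nu>\<close>, evaluated by Euler's
  reflection formula.\<close>

lemma logistic_fourier:
  fixes \<nu> :: real
  assumes "\<nu> \<noteq> 0"
  shows "has_bochner_integral lborel (\<lambda>v. cos (\<nu> * v) * logistic_density v) (pi * \<nu> / sinh (pi * \<nu>))"
    and "integrable lborel logistic_density"
proof -
  have eq: "exp ((1 + \<i> * of_real s) * of_real v
            - ((1 + \<i> * of_real s) + (1 - \<i> * of_real s)) * of_real (ln (1 + exp v)))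
      = cis (s * v) * of_real (logistic_density v)" for s v :: real
  proof -
    have pos: "(1 + exp v) > 0" by (simp add: add_pos_pos)
    have "of_real (exp (2 * ln (1 + exp v))) = complex_of_real ((1 + exp v)\<^sup>2)"
      using pos by (simp add: exp_double del: of_real_exp)
    then have "exp (2 * of_real (ln (1 + exp v))) = complex_of_real ((1 + exp v)\<^sup>2)"
      by (metis exp_of_real of_real_mult of_real_numeral)
    then show ?thesis
      by (simp add: exp_diff exp_add cis_conv_exp logistic_density_def ring_distribs mult_ac flip: exp_of_real)
  qed
  have int: "integrable lborel (\<lambda>v. cis (s * v) * of_real (logistic_density v))" for s
    using Beta_integral_exp(1)[of "1 + \<i> * of_real s" "1 - \<i> * of_real s"] unfolding eq by simp
  show "integrable lborel logistic_density"
    using integrable_Re[OF int[of 0]] by simp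
  have s: "sin (of_real pi * (\<i> * of_real \<nu>)) = \<i> * complex_of_real (sinh (pi * \<nu>))"
    using sinh_conv_sin[of "complex_of_real (pi * \<nu>)"]
    by (simp add: mult_ac sinh_field_def exp_of_real[symmetric])
  have "(LBINT v. cis (\<nu> * v) * of_real (logistic_density v))
      = Gamma (\<i> * of_real \<nu> + 1) * Gamma (1 - \<i> * of_real \<nu>)"
    using Beta_integral_exp(2)[of "1 + \<i> * of_real \<nu>" "1 - \<i> * of_real \<nu>"]
    unfolding eq by (simp add: Gamma_numeral add.commute)
  also have "\<dots> = \<i> * of_real \<nu> * (Gamma (\<i> * of_real \<nu>) * Gamma (1 - \<i> * of_real \<nu>))"
  proof -
    have "\<i> * of_real \<nu> \<notin> \<int>\<^sub>\<le>\<^sub>0"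
      using assms by (auto elim!: nonpos_Ints_cases simp: complex_eq_iff)
    then show ?thesis by (simp add: Gamma_plus1)
  qed
  also have "\<dots> = of_real (pi * \<nu> / sinh (pi * \<nu>))"
    unfolding Gamma_reflection_complex s by (simp add: field_simps)
  finally have "(LBINT v. cis (\<nu> * v) * of_real (logistic_density v)) = of_real (pi * \<nu> / sinh (pi * \<nu>))" .
  then have "has_bochner_integral lborel (\<lambda>v. cis (\<nu> * v) * of_real (logistic_density v))
      (of_real (pi * \<nu> / sinh (pi * \<nu>)))"
    using int by (simp add: has_bochner_integral_iff)
  from has_bochner_integral_bounded_linear[OF bounded_linear_Re this]
  show "has_bochner_integral lborel (\<lambda>v. cos (\<nu> * v) * logistic_density v) (pi * \<nu> / sinh (pi * \<nu>))"
    by (simp del: of_real_divide)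
qed

lemma logistic_window:
  fixes u v :: real
  assumes "u \<ge> 0"
  shows "(LBINT w. indicator {v - u..v + u} w * logistic_density w) = sinh u / (cosh u + cosh v)"
proof -
  have nz: "1 + exp w > (0::real)" for w :: real by (simp add: add_pos_pos)
  have "(LBINT w. indicator {v - u..v + u} w *\<^sub>R logistic_density w)
      = - 1 / (1 + exp (v + u)) - (- 1 / (1 + exp (v - u)))"
  proof (rule integral_FTC_atLeastAtMost)
    fix w :: real
    have "((\<lambda>w. - 1 / (1 + exp w)) has_field_derivative logistic_density w) (at w within {v - u..v + u})"
      unfolding logistic_density_def using nz[of w]
      by (auto intro!: derivative_eq_intros simp: power2_eq_square)
    then show "((\<lambda>w. - 1 / (1 + exp w)) has_vector_derivative logistic_density w) (at w within {v - u..v + u})"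
      by (simp add: has_real_derivative_iff_has_vector_derivative)
  qed (use assms in \<open>auto intro: continuous_intros\<close>)
  also have "\<dots> = 1 / (1 + exp (v - u)) - 1 / (1 + exp (v + u))" by simp
  also have "\<dots> = sinh u / (cosh u + cosh v)"
  proof -
    define U V where "U = exp u" and "V = exp v"
    have p: "U > 0" "V > 0" by (simp_all add: U_def V_def)
    have "1 / (1 + V / U) - 1 / (1 + V * U) = ((U - 1 / U) / 2) / ((U + 1 / U) / 2 + (V + 1 / V) / 2)"
    proof -
      have "1 / (1 + V / U) - 1 / (1 + V * U) = (V * (U * U - 1)) / ((U + V) * (1 + V * U))"
        using p by (simp add: divide_simps add_pos_pos add_nonneg_eq_0_iff)
             (auto simp: algebra_simps add_pos_pos)
      moreover have "(U + 1 / U) / 2 + (V + 1 / V) / 2 = ((U + V) * (1 + V * U)) / (2 * U * V)"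
        using p by (simp add: field_simps)
      moreover have "(U - 1 / U) / 2 = (U * U - 1) / (2 * U)"
        using p by (simp add: field_simps)
      moreover have "V * N / D = (N / (2 * U)) / (D / (2 * U * V))" for N D
        using p by simp
      ultimately show ?thesis by simp
    qed
    then show ?thesis
      by (simp add: U_def V_def sinh_field_def cosh_field_def exp_minus exp_add exp_diff inverse_eq_divide)
  qed
  finally show ?thesis by simp
qed

lemma cos_window:
  fixes u w \<nu> :: real
  assumes "u \<ge> 0" "\<nu> \<noteq> 0"
  shows "(LBINT v. indicator {w - u..w + u} v * cos (\<nu> * v)) = 2 * cos (\<nu> * w) * sin (\<nu> * u) / \<nu>"
proof -
  have "(LBINT v. indicator {w - u..w + u} v *\<^sub>R cos (\<nu> * v))
      = sin (\<nu> * (w + u)) / \<nu> - sin (\<nu> * (w - u)) / \<nu>"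
  proof (rule integral_FTC_atLeastAtMost)
    fix v :: real
    have "((\<lambda>v. sin (\<nu> * v) / \<nu>) has_field_derivative cos (\<nu> * v)) (at v within {w - u..w + u})"
      using assms by (auto intro!: derivative_eq_intros)
    then show "((\<lambda>v. sin (\<nu> * v) / \<nu>) has_vector_derivative cos (\<nu> * v)) (at v within {w - u..w + u})"
      by (simp add: has_real_derivative_iff_has_vector_derivative)
  qed (use assms in \<open>auto intro!: continuous_intros\<close>)
  also have "\<dots> = 2 * cos (\<nu> * w) * sin (\<nu> * u) / \<nu>"
    by (simp add: ring_distribs sin_add sin_diff diff_divide_distrib[symmetric])
  finally show ?thesis by simp
qed

text \<open>By \<open>logistic_window\<close> the kernel \<open>sinh u / (cosh u + cosh v)\<close> is the convolution of the
  logistic density with the indicator of \<open>{-u..u}\<close>; hence its Fourier transform is a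
  product.\<close>

lemma cosh_kernel_fourier_line:
  fixes u \<nu> :: real
  assumes u: "u \<ge> 0" and \<nu>: "\<nu> \<noteq> 0"
  shows "has_bochner_integral lborel (\<lambda>v. cos (\<nu> * v) * (sinh u / (cosh u + cosh v)))
           (2 * pi * sin (\<nu> * u) / sinh (pi * \<nu>))"
proof -
  define h where "h w v = (indicator {w - u..w + u} v * logistic_density w :: real)" for w v
  have ind: "indicator {w - u..w + u} v = (indicator {v - u..v + u} w :: real)" for w v
    by (auto simp: indicator_def)
  have logm [measurable]: "logistic_density \<in> borel_measurable borel"
    by (intro borel_measurable_continuous_onI continuous_intros)
  (* as a conditional, the indicator is visibly measurable in the pair (w, v) *)
  have indm: "indicator {w - u..w + u} v = (if w - u \<le> v \<and> v \<le> w + u then 1 else 0 :: real)" for w v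
    by (auto simp: indicator_def)
  have hm [measurable]: "case_prod h \<in> borel_measurable (lborel \<Otimes>\<^sub>M lborel)"
    unfolding h_def indm by measurable
  have hint: "integrable (lborel \<Otimes>\<^sub>M lborel) (case_prod h)"
  proof (rule lborel_pair.Fubini_integrable[OF hm])
    have "(LBINT v. norm (h w v)) = 2 * u * logistic_density w" for w
      using u logistic_nonneg[of w] by (simp add: h_def)
    then show "integrable lborel (\<lambda>w. LBINT v. norm (case_prod h (w, v)))"
      using logistic_fourier(2)[OF \<nu>] by simp
    show "AE w in lborel. integrable lborel (\<lambda>v. case_prod h (w, v))"
      by (auto simp: h_def intro!: AE_I2 integrable_mult_left integrable_real_indicator
          simp: emeasure_lborel_Icc_eq)
  qed
  define f where "f w v = cos (\<nu> * v) * h w v" for w v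
  have fint: "integrable (lborel \<Otimes>\<^sub>M lborel) (case_prod f)"
  proof (rule Bochner_Integration.integrable_bound[OF hint])
    show "case_prod f \<in> borel_measurable (lborel \<Otimes>\<^sub>M lborel)"
      unfolding f_def by measurable
    show "AE p in lborel \<Otimes>\<^sub>M lborel. norm (case_prod f p) \<le> norm (case_prod h p)"
      by (rule AE_I2) (auto simp: f_def abs_mult split: prod.split intro!: mult_left_le_one_le)
  qed
  have f1: "(LBINT v. f w v) = cos (\<nu> * w) * logistic_density w * (2 * sin (\<nu> * u) / \<nu>)" for w
  proof -
    have "(LBINT v. f w v) = (LBINT v. logistic_density w * (indicator {w - u..w + u} v * cos (\<nu> * v)))"
      by (simp add: f_def h_def mult_ac)
    also have "\<dots> = logistic_density w * (2 * cos (\<nu> * w) * sin (\<nu> * u) / \<nu>)"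
      by (simp only: integral_mult_right_zero cos_window[OF u \<nu>])
    finally show ?thesis by (simp add: mult_ac)
  qed
  have f2: "(LBINT w. f w v) = cos (\<nu> * v) * (sinh u / (cosh u + cosh v))" for v
  proof -
    have "(LBINT w. f w v) = (LBINT w. cos (\<nu> * v) * (indicator {v - u..v + u} w * logistic_density w))"
      by (simp add: f_def h_def ind)
    then show ?thesis
      by (simp only: integral_mult_right_zero logistic_window[OF u])
  qed
  have "integrable lborel (\<lambda>v. LBINT w. f w v)"
    by (rule lborel_pair.integrable_snd[OF fint])
  moreover have "(LBINT v. LBINT w. f w v) = 2 * pi * sin (\<nu> * u) / sinh (pi * \<nu>)"
  proof -
    have "(LBINT v. LBINT w. f w v) = (LBINT w. cos (\<nu> * w) * logistic_density w * (2 * sin (\<nu> * u) / \<nu>))"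
      using lborel_pair.Fubini_integral[OF fint] by (simp only: f1)
    also have "\<dots> = (pi * \<nu> / sinh (pi * \<nu>)) * (2 * sin (\<nu> * u) / \<nu>)"
      using logistic_fourier(1)[OF \<nu>]
      by (simp only: integral_mult_left_zero has_bochner_integral_integral_eq)
    finally show ?thesis using \<nu> by simp
  qed
  ultimately show ?thesis by (simp add: f2 has_bochner_integral_iff)
qed

lemma cosh_kernel_fourier:
  fixes u \<nu> :: real
  assumes "u \<ge> 0" "\<nu> \<noteq> 0"
  shows "(LBINT v. indicator {0<..} v * (cos (\<nu> * v) * (sinh u / (cosh u + cosh v))))
           = pi * sin (\<nu> * u) / sinh (pi * \<nu>)"
proof -
  let ?f = "\<lambda>v. cos (\<nu> * v) * (sinh u / (cosh u + cosh v))"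
  note line = cosh_kernel_fourier_line[OF assms]
  have "integrable lborel (\<lambda>v. indicator {0..} v *\<^sub>R ?f v)"
    using line by (intro integrable_mult_indicator) (auto simp: has_bochner_integral_iff)
  then have "has_bochner_integral lborel ?f (2 *\<^sub>R (LBINT v. indicator {0..} v *\<^sub>R ?f v))"
    by (intro has_bochner_integral_even_function) (auto simp: has_bochner_integral_iff)
  then have "(LBINT v. indicator {0..} v *\<^sub>R ?f v) = pi * sin (\<nu> * u) / sinh (pi * \<nu>)"
    using has_bochner_integral_eq[OF _ line] by fastforce
  also have "(LBINT v. indicator {0..} v *\<^sub>R ?f v) = (LBINT v. indicator {0<..} v *\<^sub>R ?f v)"
    by (rule integral_discrete_difference[of "{0}"]) (auto simp: indicator_def)
  finally show ?thesis by simp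
qed

section \<open>Auxiliary facts on integrability\<close>

lemma borel_measurable_cosh_sinh_real [measurable]:
  "(cosh :: real \<Rightarrow> real) \<in> borel_measurable borel"
  "(sinh :: real \<Rightarrow> real) \<in> borel_measurable borel"
  by (intro borel_measurable_continuous_onI continuous_intros)+

lemma integrable_Icc_continuous:
  fixes f :: "real \<Rightarrow> real"
  assumes "continuous_on {a..b} f"
  shows "integrable lborel (\<lambda>u. indicator {a..b} u * f u)"
  using borel_integrable_atLeastAtMost'[OF assms] by (simp add: set_integrable_def)

lemma integrable_mult_prod:
  fixes g :: "'a \<Rightarrow> real" and h :: "'b \<Rightarrow> real"
  assumes "pair_sigma_finite M N" and g: "integrable M g" and h: "integrable N h"
  shows "integrable (M \<Otimes>\<^sub>M N) (\<lambda>(x, y). g x * h y)"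
proof -
  interpret pair_sigma_finite M N by fact
  have [measurable]: "g \<in> borel_measurable M" "h \<in> borel_measurable N" using g h by auto
  show ?thesis
  proof (rule Fubini_integrable)
    show "integrable M (\<lambda>x. LINT y|N. norm (case (x, y) of (x, y) \<Rightarrow> g x * h y))"
      using integrable_mult_left[OF integrable_norm[OF g]] by (simp add: abs_mult)
  qed (use h in auto)
qed

section \<open>Bessel functions of imaginary order\<close>

text \<open>The real-valued functions \<open>K\<close> of order \<open>\<i> \<nu>\<close> and \<open>J(x, \<i> \<mu>, \<pi>)\<close>, for real \<open>\<nu>\<close>
  and \<open>\<mu>\<close>.\<close>

definition K_imag :: "real \<Rightarrow> real \<Rightarrow> real" where
  "K_imag \<nu> x = (LBINT u. indicator {0<..} u * (exp (- x * cosh u) * cos (\<nu> * u)))"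

definition J_imag :: "real \<Rightarrow> real \<Rightarrow> real" where
  "J_imag \<mu> x = (LBINT u. indicator {0..pi} u * (exp (- x * cosh u) * cos (\<mu> * u)))"

lemma cosh_imag: "cosh (\<i> * of_real t) = complex_of_real (cos t)"
  by (simp add: cosh_conv_cos cos_of_real mult.assoc[symmetric])

lemma bessel_K_imag: "bessel_K (\<i> * of_nat n) x = of_real (K_imag (real n) x)"
proof -
  have "cosh (\<i> * of_nat n * complex_of_real u) = of_real (cos (real n * u))" for u
    using cosh_imag[of "real n * u"] by (simp add: mult.assoc)
  then show ?thesis
    unfolding bessel_K_def K_imag_def set_lebesgue_integral_def integral_complex_of_real[symmetric]
    by (simp add: scaleR_conv_of_real)
qed

lemma incomplete_bessel_imag:
  "incomplete_bessel (of_real x) (\<i> * of_nat m) pi = of_real (J_imag (real m) x)"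
proof -
  have "cosh (\<i> * of_nat m * complex_of_real u) = of_real (cos (real m * u))" for u
    using cosh_imag[of "real m * u"] by (simp add: mult.assoc)
  moreover have "exp (- of_real x * of_real (cosh u)) = complex_of_real (exp (- x * cosh u))" for u
    by (simp flip: exp_of_real)
  ultimately show ?thesis
    unfolding incomplete_bessel_def J_imag_def zero_ereal_def
    by (simp add: interval_integral_Icc set_lebesgue_integral_def scaleR_conv_of_real
        flip: integral_complex_of_real)
qed

text \<open>The boundary term of the integration by parts vanishes for integral \<open>\<mu>\<close>. The factor
  \<open>x / \<mu>\<close> gained here cancels the singularity of \<open>dx / x\<close> at \<open>0\<close> and matches the
  weight \<open>1 / m\<close> in the hypothesis on the coefficients.\<close>

lemma J_imag_by_parts:
  assumes "\<mu> \<noteq> 0" "sin (\<mu> * pi) = 0"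
  shows "J_imag \<mu> x =
    x / \<mu> * (LBINT u. indicator {0..pi} u * (exp (- x * cosh u) * (sinh u * sin (\<mu> * u))))"
proof -
  let ?c = "\<lambda>u. exp (- x * cosh u) * cos (\<mu> * u)"
  let ?s = "\<lambda>u. exp (- x * cosh u) * (sinh u * sin (\<mu> * u))"
  let ?F = "\<lambda>u. exp (- x * cosh u) * sin (\<mu> * u) / \<mu>"
  have int: "integrable lborel (\<lambda>u. indicator {0..pi} u * ?c u)"
    "integrable lborel (\<lambda>u. indicator {0..pi} u * ?s u)"
    by (intro integrable_Icc_continuous continuous_intros)+
  have "(LBINT u. indicator {0..pi} u *\<^sub>R (?c u - x / \<mu> * ?s u)) = ?F pi - ?F 0"
  proof (rule integral_FTC_atLeastAtMost)
    fix u :: real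
    have "(?F has_field_derivative ?c u - x / \<mu> * ?s u) (at u within {0..pi})"
      using assms(1) by (auto intro!: derivative_eq_intros simp: field_simps)
    then show "(?F has_vector_derivative ?c u - x / \<mu> * ?s u) (at u within {0..pi})"
      by (simp add: has_real_derivative_iff_has_vector_derivative)
  qed (use assms in \<open>auto intro!: continuous_intros\<close>)
  also have "\<dots> = 0" using assms(2) by simp
  also have "(\<lambda>u. indicator {0..pi} u *\<^sub>R (?c u - x / \<mu> * ?s u))
      = (\<lambda>u. indicator {0..pi} u * ?c u - x / \<mu> * (indicator {0..pi} u * ?s u))"
    by (simp add: right_diff_distrib mult_ac)
  finally have "J_imag \<mu> x - x / \<mu> * (LBINT u. indicator {0..pi} u * ?s u) = 0"
    unfolding J_imag_def
    by (subst (asm) Bochner_Integration.integral_diff[OF int(1) integrable_mult_right[OF int(2)]])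
       (simp only: integral_mult_right_zero)
  then show ?thesis by simp
qed

lemma sin_of_nat_mult_pi: "sin (real m * pi) = 0"
  by (simp add: sin_npi)

lemma kernel_bound:
  fixes x u \<mu> :: real
  assumes "x \<ge> 0" "u \<in> {0..pi}"
  shows "\<bar>exp (- x * cosh u) * (sinh u * sin (\<mu> * u))\<bar> \<le> exp (- x) * sinh pi"
proof -
  have "exp (- x * cosh u) \<le> exp (- x)"
    using assms cosh_real_ge_1[of u] mult_left_mono[of 1 "cosh u" x] by simp
  moreover have "\<bar>sinh u * sin (\<mu> * u)\<bar> \<le> sinh pi * 1"
    unfolding abs_mult using assms by (intro mult_mono) auto
  ultimately show ?thesis
    unfolding abs_mult[of "exp _"] by (intro mult_mono) auto
qed

lemma J_imag_bound:
  assumes "x \<ge> 0" "m > 0"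
  shows "\<bar>J_imag (real m) x\<bar> \<le> x * exp (- x) * (pi * sinh pi) / real m"
proof -
  let ?s = "\<lambda>u. exp (- x * cosh u) * (sinh u * sin (real m * u))"
  have "norm (LBINT u. indicator {0..pi} u * ?s u) \<le> (LBINT u. indicator {0..pi} u * (exp (- x) * sinh pi))"
  proof (rule Bochner_Integration.integral_norm_bound_integral)
    show "integrable lborel (\<lambda>u. indicator {0..pi} u * ?s u)"
      by (intro integrable_Icc_continuous continuous_intros)
    show "integrable lborel (\<lambda>u. indicator {0..pi} u * (exp (- x) * sinh pi))"
      by (intro integrable_mult_left integrable_real_indicator) auto
    show "norm (indicator {0..pi} u * ?s u) \<le> indicator {0..pi} u * (exp (- x) * sinh pi)" for u
      using kernel_bound[OF assms(1), of u "real m"] by (auto simp: indicator_def)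
  qed
  also have "\<dots> = pi * (exp (- x) * sinh pi)" by simp
  finally have "x / real m * norm (LBINT u. indicator {0..pi} u * ?s u) \<le> x / real m * (pi * (exp (- x) * sinh pi))"
    using assms by (intro mult_left_mono) auto
  then show ?thesis
    using assms by (subst J_imag_by_parts) (auto simp: sin_of_nat_mult_pi abs_mult mult_ac)
qed

section \<open>The Laplace transform of the Macdonald function\<close>

lemma exp_integral_Ioi:
  fixes c :: real
  assumes "c > 0"
  shows "has_bochner_integral lborel (\<lambda>x. indicator {0<..} x * exp (- x * c)) (1 / c)"
proof -
  have "((\<lambda>x. - exp (- x * c) / c) \<longlongrightarrow> 0) at_top"
    using assms by real_asymp
  then have "(\<integral>\<^sup>+x. ennreal (exp (- x * c)) * indicator {0..} x \<partial>lborel)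
      = ennreal (0 - (- exp (- 0 * c) / c))"
    using assms by (intro nn_integral_FTC_atLeast) (auto intro!: derivative_eq_intros)
  then have "(\<integral>\<^sup>+x. ennreal (indicator {0..} x * exp (- x * c)) \<partial>lborel) = ennreal (1 / c)"
    by (simp add: ennreal_mult' ennreal_indicator mult.commute)
  then have "has_bochner_integral lborel (\<lambda>x. indicator {0..} x * exp (- x * c)) (1 / c)"
    using assms by (subst (asm) nn_integral_eq_integrable) (auto simp: has_bochner_integral_iff)
  then show ?thesis
    by (rule has_bochner_integral_discrete_difference[of "{0}", THEN iffD1, rotated 4])
       (auto simp: indicator_def)
qed

lemma K_laplace_pair:
  fixes u \<nu> :: real
  shows "integrable (lborel \<Otimes>\<^sub>M lborel) (\<lambda>(v, x). indicator {0<..} v * indicator {0<..} x *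
           (exp (- x * (cosh u + cosh v)) * cos (\<nu> * v)) :: real)"
proof -
  have *: "has_bochner_integral lborel (\<lambda>x. indicator {0<..} v * indicator {0<..} x *
           (exp (- x * (cosh u + cosh v)) * c)) (indicator {0<..} v * c * (1 / (cosh u + cosh v)))" for v c :: real
    using has_bochner_integral_mult_right[OF exp_integral_Ioi[of "cosh u + cosh v"], of "indicator {0<..} v * c"]
    by (simp add: add_pos_pos mult_ac)
  have expi: "integrable lborel (\<lambda>v::real. indicator {0<..} v * exp (- v))"
    using exp_integral_Ioi[of 1] by (simp add: has_bochner_integral_iff)
  show ?thesis
  proof (rule lborel_pair.Fubini_integrable)
    have "integrable lborel (\<lambda>v. indicator {0<..} v * \<bar>cos (\<nu> * v)\<bar> * (1 / (cosh u + cosh v)))"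
    proof (rule Bochner_Integration.integrable_bound[OF integrable_mult_right[OF expi, of 2]])
      show "AE v in lborel. norm (indicator {0<..} v * \<bar>cos (\<nu> * v)\<bar> * (1 / (cosh u + cosh v)))
              \<le> norm (2 * (indicator {0<..} v * exp (- v)))"
      proof (rule AE_I2)
        fix v :: real
        have "exp v / 2 \<le> cosh u + cosh v"
          using cosh_real_pos[of u] exp_gt_zero[of "- v"] unfolding cosh_field_def[of v] by argo
        then have "1 / (cosh u + cosh v) \<le> 1 / (exp v / 2)"
          by (intro divide_left_mono) (auto simp: add_pos_pos)
        then have "\<bar>cos (\<nu> * v)\<bar> * (1 / (cosh u + cosh v)) \<le> 1 * (1 / (exp v / 2))"
          by (intro mult_mono) (auto simp: add_nonneg_nonneg)
        then show "norm (indicator {0<..} v * \<bar>cos (\<nu> * v)\<bar> * (1 / (cosh u + cosh v)))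
              \<le> norm (2 * (indicator {0<..} v * exp (- v)))"
          by (simp add: indicator_def exp_minus field_simps abs_mult add_pos_pos)
      qed
    qed simp
    then show "integrable lborel (\<lambda>v. LBINT x. norm (case (v, x) of (v, x) \<Rightarrow>
        indicator {0<..} v * indicator {0<..} x * (exp (- x * (cosh u + cosh v)) * cos (\<nu> * v))))"
      using has_bochner_integral_integral_eq[OF *] by (simp add: abs_mult)
  qed (use * in \<open>auto simp: has_bochner_integral_iff\<close>)
qed

lemma K_laplace:
  fixes u \<nu> :: real
  shows "integrable lborel (\<lambda>x. indicator {0<..} x * exp (- x * cosh u) * K_imag \<nu> x)"
    and "(LBINT x. indicator {0<..} x * exp (- x * cosh u) * K_imag \<nu> x)
           = (LBINT v. indicator {0<..} v * cos (\<nu> * v) / (cosh u + cosh v))"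
proof -
  define f :: "real \<Rightarrow> real \<Rightarrow> real"
    where "f v x = indicator {0<..} v * indicator {0<..} x * (exp (- x * (cosh u + cosh v)) * cos (\<nu> * v))" for v x
  have pair: "integrable (lborel \<Otimes>\<^sub>M lborel) (case_prod f)"
    using K_laplace_pair[of u \<nu>] by (simp add: f_def[abs_def])
  have f1: "(LBINT x. f v x) = indicator {0<..} v * cos (\<nu> * v) / (cosh u + cosh v)" for v
  proof -
    have "(LBINT x. f v x) = (LBINT x. (indicator {0<..} v * cos (\<nu> * v)) *
        (indicator {0<..} x * exp (- x * (cosh u + cosh v))))"
      by (simp add: f_def mult_ac)
    also have "\<dots> = (indicator {0<..} v * cos (\<nu> * v)) * (1 / (cosh u + cosh v))"
      using exp_integral_Ioi[of "cosh u + cosh v"]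
      by (simp only: integral_mult_right_zero) (simp add: has_bochner_integral_iff add_pos_pos)
    finally show ?thesis by simp
  qed
  have f2: "(LBINT v. f v x) = indicator {0<..} x * exp (- x * cosh u) * K_imag \<nu> x" for x
  proof -
    have "(LBINT v. f v x) = (LBINT v. (indicator {0<..} x * exp (- x * cosh u)) *
        (indicator {0<..} v * (exp (- x * cosh v) * cos (\<nu> * v))))"
      by (rule Bochner_Integration.integral_cong)
         (simp_all add: f_def ring_distribs exp_add exp_diff exp_minus field_simps)
    then show ?thesis by (simp only: integral_mult_right_zero K_imag_def)
  qed
  show "integrable lborel (\<lambda>x. indicator {0<..} x * exp (- x * cosh u) * K_imag \<nu> x)"
    using lborel_pair.integrable_snd[OF pair] by (simp only: f2)
  show "(LBINT x. indicator {0<..} x * exp (- x * cosh u) * K_imag \<nu> x)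
           = (LBINT v. indicator {0<..} v * cos (\<nu> * v) / (cosh u + cosh v))"
    using lborel_pair.Fubini_integral[OF pair] by (simp only: f1 f2)
qed

lemma borel_measurable_K_imag [measurable]: "K_imag \<nu> \<in> borel_measurable borel"
  unfolding K_imag_def[abs_def] by measurable

lemma borel_measurable_J_imag [measurable]: "J_imag \<mu> \<in> borel_measurable borel"
  unfolding J_imag_def[abs_def] by measurable

lemma integrable_exp_cosh:
  fixes x :: real
  assumes "x > 0"
  shows "integrable lborel (\<lambda>u. indicator {0<..} u * exp (- x * cosh u))"
proof (rule Bochner_Integration.integrable_bound)
  show "integrable lborel (\<lambda>u. indicator {0<..} u * exp (- u * x))"
    using exp_integral_Ioi[of x] assms by (simp add: has_bochner_integral_iff)
  show "AE u in lborel. norm (indicator {0<..} u * exp (- x * cosh u)) \<le> norm (indicator {0<..} u * exp (- u * x))"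
  proof (rule AE_I2)
    fix u :: real
    have "u \<le> cosh u"
    proof (cases "u \<ge> 0")
      case True
      have "2 * u \<le> 1 + u + u\<^sup>2 / 2"
        using zero_le_power2[of "u - 1"] by (simp add: power2_diff)
      also have "\<dots> \<le> exp u" by (rule exp_lower_Taylor_quadratic[OF True])
      finally show ?thesis using exp_gt_zero[of "- u"] unfolding cosh_field_def by argo
    qed (use cosh_real_pos[of u] in linarith)
    then have "u * x \<le> x * cosh u" using assms by (simp add: mult.commute)
    then show "norm (indicator {0<..} u * exp (- x * cosh u)) \<le> norm (indicator {0<..} u * exp (- u * x))"
      by (simp add: indicator_def)
  qed
qed measurable

lemma K_imag_bound:
  assumes "x > 0"
  shows "\<bar>K_imag \<nu> x\<bar> \<le> K_imag 0 x"
  unfolding K_imag_def real_norm_def[symmetric]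
proof (rule Bochner_Integration.integral_norm_bound_integral)
  show i: "integrable lborel (\<lambda>u. indicator {0<..} u * (exp (- x * cosh u) * cos (0 * u)))"
    using integrable_exp_cosh[OF assms] by simp
  have le: "norm (indicator {0<..} u * (exp (- x * cosh u) * cos (\<nu> * u)))
      \<le> indicator {0<..} u * (exp (- x * cosh u) * cos (0 * u))" for u
    by (simp add: indicator_def abs_mult)
  then show "norm (indicator {0<..} u * (exp (- x * cosh u) * cos (\<nu> * u)))
      \<le> indicator {0<..} u * (exp (- x * cosh u) * cos (0 * u))" for u .
  show "integrable lborel (\<lambda>u. indicator {0<..} u * (exp (- x * cosh u) * cos (\<nu> * u)))"
    by (rule Bochner_Integration.integrable_bound[OF i])
       (use le in \<open>auto intro!: AE_I2 order_trans[OF _ abs_ge_self]\<close>)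
qed

text \<open>Multiplication by \<open>sinh u\<close> keeps the formula valid at \<open>u = 0\<close>.\<close>

lemma K_laplace_sinh:
  assumes "u \<ge> 0" "\<nu> \<noteq> 0"
  shows "sinh u * (LBINT x. indicator {0<..} x * exp (- x * cosh u) * K_imag \<nu> x)
           = pi * sin (\<nu> * u) / sinh (pi * \<nu>)"
proof -
  have "sinh u * (LBINT v. indicator {0<..} v * cos (\<nu> * v) / (cosh u + cosh v))
      = (LBINT v. sinh u * (indicator {0<..} v * cos (\<nu> * v) / (cosh u + cosh v)))"
    by (simp only: integral_mult_right_zero)
  also have "\<dots> = (LBINT v. indicator {0<..} v * (cos (\<nu> * v) * (sinh u / (cosh u + cosh v))))"
    by (simp add: mult_ac)
  finally show ?thesis using cosh_kernel_fourier[OF assms] by (simp only: K_laplace(2))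
qed

section \<open>Biorthogonality\<close>

lemma sin_orthogonal:
  assumes "m > 0" "n > 0"
  shows "(LBINT u. indicator {0..pi} u * (sin (real m * u) * sin (real n * u))) = (if m = n then pi / 2 else 0)"
proof -
  have c: "(LBINT u. indicator {0..pi} u * cos (real_of_int k * u)) = (if k = 0 then pi else 0)" for k
  proof (cases "k = 0")
    case False
    have "(LBINT u. indicator {0..pi} u *\<^sub>R cos (real_of_int k * u))
        = sin (real_of_int k * pi) / k - sin (real_of_int k * 0) / k"
    proof (rule integral_FTC_atLeastAtMost)
      fix u :: real
      have "((\<lambda>u. sin (real_of_int k * u) / k) has_field_derivative cos (real_of_int k * u)) (at u within {0..pi})"
        using False by (auto intro!: derivative_eq_intros)
      then show "((\<lambda>u. sin (real_of_int k * u) / k) has_vector_derivative cos (real_of_int k * u)) (at u within {0..pi})"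
        by (simp add: has_real_derivative_iff_has_vector_derivative)
    qed (auto intro!: continuous_intros)
    then show ?thesis using False by (simp add: sin_int_times_real mult.commute)
  qed simp
  have int: "integrable lborel (\<lambda>u. indicator {0..pi} u * cos (real_of_int k * u))" for k
    by (intro integrable_Icc_continuous continuous_intros)
  have "(LBINT u. indicator {0..pi} u * (sin (real m * u) * sin (real n * u)))
     = (LBINT u. (indicator {0..pi} u * cos (real_of_int (int m - int n) * u)
          - indicator {0..pi} u * cos (real_of_int (int m + int n) * u)) / 2)"
    by (rule Bochner_Integration.integral_cong)
       (simp_all add: sin_times_sin left_diff_distrib distrib_right
          right_diff_distrib diff_divide_distrib)
  also have "\<dots> = ((if int m - int n = 0 then pi else 0) - (if int m + int n = 0 then pi else 0)) / 2"
    by (simp only: integral_divide_zero Bochner_Integration.integral_diff[OF int int] c)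
  finally show ?thesis using assms by (cases "m = n") (simp_all only:, simp_all)
qed

text \<open>An integrable function of \<open>x\<close> that dominates \<open>m K(x) J(x, \<i> m, \<pi>) / x\<close> for every
  \<open>m \<ge> 1\<close> and every imaginary order of \<open>K\<close>.\<close>

definition KJ_bound :: "real \<Rightarrow> real" where
  "KJ_bound x = indicator {0<..} x * exp (- x) * K_imag 0 x * (pi * sinh pi)"

lemma integrable_KJ_bound: "integrable lborel KJ_bound"
  using K_laplace(1)[of 0 0] unfolding KJ_bound_def[abs_def] by (intro integrable_mult_left) simp

lemma KJ_le_bound:
  assumes "m > 0"
  shows "\<bar>indicator {0<..} x * (K_imag \<nu> x * J_imag (real m) x / x)\<bar> \<le> KJ_bound x / real m"
proof (cases "x > 0")
  case True
  have "\<bar>K_imag \<nu> x\<bar> * \<bar>J_imag (real m) x\<bar> \<le> K_imag 0 x * (x * exp (- x) * (pi * sinh pi) / real m)"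
    using K_imag_bound[OF True, of \<nu>] J_imag_bound[of x m] assms True
    by (intro mult_mono) auto
  then have "\<bar>K_imag \<nu> x\<bar> * \<bar>J_imag (real m) x\<bar> / x
      \<le> K_imag 0 x * (x * exp (- x) * (pi * sinh pi) / real m) / x"
    using True by (intro divide_right_mono) auto
  then show ?thesis using True by (simp add: KJ_bound_def abs_mult mult_ac)
qed (simp add: KJ_bound_def)

lemma integrable_KJ:
  assumes "m > 0"
  shows "integrable lborel (\<lambda>x. indicator {0<..} x * (K_imag \<nu> x * J_imag (real m) x / x))"
proof (rule Bochner_Integration.integrable_bound)
  show "integrable lborel (\<lambda>x. KJ_bound x / real m)" using integrable_KJ_bound by simp
  show "AE x in lborel. norm (indicator {0<..} x * (K_imag \<nu> x * J_imag (real m) x / x))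
      \<le> norm (KJ_bound x / real m)"
    unfolding real_norm_def by (intro AE_I2 order_trans[OF KJ_le_bound[OF assms] abs_ge_self])
qed measurable

text \<open>Inserting \<open>J_imag_by_parts\<close> and integrating over \<open>x\<close> first leaves, by
  \<open>K_laplace_sinh\<close>, the orthogonality integral of sines.\<close>

lemma KJ_biorthogonal:
  assumes m: "m > 0" and n: "n > 0"
  shows "(LBINT x. indicator {0<..} x * (K_imag (real n) x * J_imag (real m) x / x))
           = (if m = n then pi\<^sup>2 / (2 * real n * sinh (pi * real n)) else 0)"
proof -
  define f :: "real \<Rightarrow> real \<Rightarrow> real" where
    "f x u = indicator {0<..} x * K_imag (real n) x *
       (indicator {0..pi} u * (exp (- x * cosh u) * (sinh u * sin (real m * u)))) / real m" for x u
  have pair: "integrable (lborel \<Otimes>\<^sub>M lborel) (case_prod f)"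
  proof (rule Bochner_Integration.integrable_bound)
    show "integrable (lborel \<Otimes>\<^sub>M lborel)
      (\<lambda>(x, u). (indicator {0<..} x * exp (- x) * K_imag 0 x) * (indicator {0..pi} u * (sinh pi / real m)))"
      using K_laplace(1)[of 0 0]
      by (intro integrable_mult_prod lborel_pair.pair_sigma_finite_axioms) auto
    show "case_prod f \<in> borel_measurable (lborel \<Otimes>\<^sub>M lborel)"
      unfolding f_def by measurable
    show "AE p in lborel \<Otimes>\<^sub>M lborel. norm (case_prod f p) \<le> norm (case p of (x, u) \<Rightarrow>
      (indicator {0<..} x * exp (- x) * K_imag 0 x) * (indicator {0..pi} u * (sinh pi / real m)))"
    proof (rule AE_I2, clarify)
      fix x u :: real
      show "norm (f x u) \<le>
        norm ((indicator {0<..} x * exp (- x) * K_imag 0 x) * (indicator {0..pi} u * (sinh pi / real m)))"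
      proof (cases "x > 0 \<and> u \<in> {0..pi}")
        case True
        have "\<bar>K_imag (real n) x\<bar> * \<bar>exp (- x * cosh u) * (sinh u * sin (real m * u))\<bar>
            \<le> K_imag 0 x * (exp (- x) * sinh pi)"
          using True K_imag_bound[of x "real n"] by (intro mult_mono kernel_bound) auto
        then have "\<bar>K_imag (real n) x\<bar> * \<bar>exp (- x * cosh u) * (sinh u * sin (real m * u))\<bar> / real m
            \<le> \<bar>K_imag 0 x * (exp (- x) * sinh pi)\<bar> / real m"
          by (intro divide_right_mono) auto
        then show ?thesis using True by (simp add: f_def abs_mult mult_ac)
      qed (auto simp: f_def)
    qed
  qed
  have f1: "(LBINT u. f x u) = indicator {0<..} x * (K_imag (real n) x * J_imag (real m) x / x)" for x
  proof -
    have "(LBINT u. f x u) = (LBINT u. (indicator {0<..} x * K_imag (real n) x / real m) *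
         (indicator {0..pi} u * (exp (- x * cosh u) * (sinh u * sin (real m * u)))))"
      by (simp add: f_def)
    then show ?thesis
      using m by (simp only: integral_mult_right_zero)
        (auto simp: indicator_def J_imag_by_parts sin_of_nat_mult_pi)
  qed
  have f2: "(LBINT x. f x u) = pi / (real m * sinh (pi * real n)) *
      (indicator {0..pi} u * (sin (real m * u) * sin (real n * u)))" for u
  proof -
    have "(LBINT x. f x u) = (LBINT x. (indicator {0..pi} u * sinh u * sin (real m * u) / real m) *
        (indicator {0<..} x * exp (- x * cosh u) * K_imag (real n) x))"
      by (simp add: f_def mult_ac)
    also have "\<dots> = indicator {0..pi} u * sin (real m * u) / real m *
        (sinh u * (LBINT x. indicator {0<..} x * exp (- x * cosh u) * K_imag (real n) x))"
      by (simp only: integral_mult_right_zero) simp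
    also have "\<dots> = indicator {0..pi} u * sin (real m * u) / real m *
        (pi * sin (real n * u) / sinh (pi * real n))"
    proof (cases "u \<in> {0..pi}")
      case True
      then show ?thesis using n by (subst K_laplace_sinh) auto
    qed simp
    finally show ?thesis by simp
  qed
  have "(LBINT x. indicator {0<..} x * (K_imag (real n) x * J_imag (real m) x / x)) =
     (LBINT u. LBINT x. f x u)"
    using lborel_pair.Fubini_integral[OF pair] by (simp only: f1)
  also have "\<dots> = pi / (real m * sinh (pi * real n)) * (if m = n then pi / 2 else 0)"
    by (simp only: f2 integral_mult_right_zero sin_orthogonal[OF m n])
  finally show ?thesis by (simp add: power2_eq_square)
qed

section \<open>The inversion formula\<close>

theorem theorem2:
  fixes a :: "nat \<Rightarrow> complex"
  assumes "summable (\<lambda>m. norm (a (Suc m)) / real (Suc m))"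
  shows
    "(\<forall>x::real. x > 0 \<longrightarrow>
        summable (\<lambda>m. norm (a (Suc m) *
          incomplete_bessel (complex_of_real x) (\<i> * of_nat (Suc m)) pi))) \<and>
     (\<forall>n::nat. n \<ge> 1 \<longrightarrow>
        set_integrable lborel {0<..} (\<lambda>x::real.
          norm (bessel_K (\<i> * of_nat n) x) *
          (\<Sum>m. norm (a (Suc m) *
            incomplete_bessel (complex_of_real x) (\<i> * of_nat (Suc m)) pi)) / x) \<and>
        set_integrable lborel {0<..} (\<lambda>x::real.
          bessel_K (\<i> * of_nat n) x *
          (\<Sum>m. a (Suc m) *
            incomplete_bessel (complex_of_real x) (\<i> * of_nat (Suc m)) pi) / complex_of_real x) \<and>
        a n = complex_of_real (2 / pi\<^sup>2 * real n * sinh (pi * real n)) *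
          (LINT x:{0<..}|lborel.
            bessel_K (\<i> * of_nat n) x *
            (\<Sum>m. a (Suc m) *
              incomplete_bessel (complex_of_real x) (\<i> * of_nat (Suc m)) pi) / complex_of_real x))"
proof -
  define Jc where "Jc m x = a (Suc m) * incomplete_bessel (of_real x) (\<i> * of_nat (Suc m)) pi" for m x
  have Jc: "Jc m x = a (Suc m) * of_real (J_imag (real (Suc m)) x)" for m x
    unfolding Jc_def incomplete_bessel_imag ..
  have summ: "summable (\<lambda>m. norm (Jc m x))" if "x > 0" for x
  proof (rule summable_comparison_test')
    show "summable (\<lambda>m. norm (a (Suc m)) / real (Suc m) * (x * exp (- x) * (pi * sinh pi)))"
      by (rule summable_mult2[OF assms])
    fix m :: nat
    have "norm (a (Suc m)) * \<bar>J_imag (real (Suc m)) x\<bar>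
        \<le> norm (a (Suc m)) * (x * exp (- x) * (pi * sinh pi) / real (Suc m))"
      using that by (intro mult_left_mono J_imag_bound) auto
    then show "norm (norm (Jc m x)) \<le> norm (a (Suc m)) / real (Suc m) * (x * exp (- x) * (pi * sinh pi))"
      by (simp add: Jc norm_mult del: of_nat_Suc)
  qed
  have main: "set_integrable lborel {0<..} (\<lambda>x. norm (bessel_K (\<i> * of_nat n) x) * (\<Sum>m. norm (Jc m x)) / x)
     \<and> set_integrable lborel {0<..} (\<lambda>x. bessel_K (\<i> * of_nat n) x * (\<Sum>m. Jc m x) / of_real x)
     \<and> a n = of_real (2 / pi\<^sup>2 * real n * sinh (pi * real n)) *
        (LINT x:{0<..}|lborel. bessel_K (\<i> * of_nat n) x * (\<Sum>m. Jc m x) / of_real x)"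
    if n: "n \<ge> 1" for n :: nat
  proof -
    define k where "k m x = indicator {0<..} x * (K_imag (real n) x * J_imag (real (Suc m)) x / x)" for m x
    define F where "F m x = a (Suc m) * of_real (k m x)" for m x
    have kint: "integrable lborel (k m)" for m
      unfolding k_def[abs_def] by (rule integrable_KJ) simp
    have Fint: "integrable lborel (F m)" for m
      unfolding F_def[abs_def] using kint[of m] by (intro integrable_mult_right) simp
    have norm_F: "norm (F m x) \<le> norm (a (Suc m)) / real (Suc m) * KJ_bound x" for m x
      using mult_left_mono[OF KJ_le_bound[of "Suc m" x "real n"], of "norm (a (Suc m))"]
      unfolding F_def k_def norm_mult norm_of_real by simp
    have F_summ: "AE x in lborel. summable (\<lambda>m. norm (F m x))"
      by (intro AE_I2 summable_comparison_test'[OF summable_mult2[OF assms]])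
         (use norm_F in auto)
    have F_int_summ: "summable (\<lambda>m. LBINT x. norm (F m x))"
    proof (rule summable_comparison_test'[OF summable_mult2[OF assms]])
      fix m :: nat
      have "(LBINT x. norm (F m x)) \<le> (LBINT x. norm (a (Suc m)) / real (Suc m) * KJ_bound x)"
        using norm_F by (intro integral_mono integrable_norm Fint integrable_mult_right integrable_KJ_bound)
      then show "norm (LBINT x. norm (F m x)) \<le> norm (a (Suc m)) / real (Suc m) * (LBINT x. KJ_bound x)"
        by (simp only: integral_mult_right_zero) simp
    qed
    have sum_F: "indicator {0<..} x *\<^sub>R (bessel_K (\<i> * of_nat n) x * (\<Sum>m. Jc m x) / of_real x)
        = (\<Sum>m. F m x)" for x
    proof (cases "x > 0")
      case True
      have "summable (\<lambda>m. Jc m x)" using summ[OF True] by (rule summable_norm_cancel)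
      then have "bessel_K (\<i> * of_nat n) x * (\<Sum>m. Jc m x) / of_real x
          = (\<Sum>m. bessel_K (\<i> * of_nat n) x * Jc m x / of_real x)"
        by (simp add: suminf_mult suminf_divide summable_mult)
      also have "\<dots> = (\<Sum>m. F m x)"
        using True by (simp add: F_def k_def Jc bessel_K_imag mult_ac del: of_nat_Suc)
      finally show ?thesis using True by simp
    qed (simp add: F_def k_def)
    have sum_norm_F: "indicator {0<..} x *\<^sub>R (norm (bessel_K (\<i> * of_nat n) x) * (\<Sum>m. norm (Jc m x)) / x)
        = (\<Sum>m. norm (F m x))" for x
    proof (cases "x > 0")
      case True
      have "norm (bessel_K (\<i> * of_nat n) x) * (\<Sum>m. norm (Jc m x)) / x
          = (\<Sum>m. norm (bessel_K (\<i> * of_nat n) x) * norm (Jc m x) / x)"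
        using summ[OF True] by (simp add: suminf_mult suminf_divide summable_mult)
      also have "\<dots> = (\<Sum>m. norm (F m x))"
        using True by (simp add: F_def k_def Jc bessel_K_imag norm_mult norm_divide abs_mult mult_ac del: of_nat_Suc)
      finally show ?thesis using True by simp
    qed (simp add: F_def k_def)
    have "integrable lborel (\<lambda>x. \<Sum>m. norm (F m x))"
      using F_summ F_int_summ by (intro integrable_suminf integrable_norm Fint) auto
    moreover have "integrable lborel (\<lambda>x. \<Sum>m. F m x)"
      by (rule integrable_suminf[OF Fint F_summ F_int_summ])
    moreover have "(LBINT x. \<Sum>m. F m x) = a n * of_real (pi\<^sup>2 / (2 * real n * sinh (pi * real n)))"
    proof -
      (* the term F m carries the coefficient a (Suc m), so a n belongs to m = n - 1 *)
      have "(LBINT x. F m x) = (if m = n - 1 then a n * of_real (pi\<^sup>2 / (2 * real n * sinh (pi * real n))) else 0)" for m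
      proof -
        have "(LBINT x. F m x) = a (Suc m) * of_real (LBINT x. k m x)"
          unfolding F_def by (simp only: integral_mult_right_zero integral_complex_of_real)
        also have "(LBINT x. k m x) = (if Suc m = n then pi\<^sup>2 / (2 * real n * sinh (pi * real n)) else 0)"
          unfolding k_def using n by (intro KJ_biorthogonal) auto
        finally show ?thesis using n by auto
      qed
      then show ?thesis
        using integral_suminf[OF Fint F_summ F_int_summ]
          suminf_finite[of "{n - 1}" "\<lambda>m. LBINT x. F m x"] by simp
    qed
    ultimately show ?thesis
      using n unfolding set_integrable_def set_lebesgue_integral_def sum_F sum_norm_F
      by (simp flip: of_real_mult)
  qed
  show ?thesis
    using summ main unfolding Jc_def by blast
qed

end
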